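(* Let $\Delta$ be an abstract simplicial complex on $[m]=\{1,\dots,m\}$, let $r_1,\dots,r_m$ be positive integers, and let $A_\Delta$ be the matrix of the hierarchical log-linear model on $\Delta$ with state space sizes $r_1,\dots,r_m$. Assume that $r_1=r_2=\dots=r_m=r$. Then the rank of $A_\Delta$ is $$E(\Delta;\log(r))=e_0+e_1r+\dots+e_dr^d,$$ where $d=\dim(\Delta)+1$ and $(e_0,\dots,e_d)$ is the $e$-vector of $\Delta$.
   Context: Simplicial complexes are finite and the empty face is counted as a face. Exponential Hilbert series and $e$-vector: let $k$ be a field and $S=k[x_1,\dots,x_m]$. The Stanley-Reisner ideal $I_\Delta\subseteq S$ is generated by the monomials $\prod_{i\in\tau}x_i$ with $\tau\subseteq[m]$, $\tau\notin\Delta$. The exponential Hilbert series is $E(S/I_\Delta;x_1,\dots,x_m)=\sum_{\mathbf{a}\in\mathbb{N}^m}\dim_k\big((S/I_\Delta)_{\mathbf{a}}\big)\frac{\mathbf{x}^{\mathbf{a}}}{\mathbf{a}!}$, with $\mathbf{a}!=a_1!\cdots a_m!$, and $E(\Delta;t):=E(S/I_\Delta;t)$ denotes the coarse series obtained by setting all $x_i=t$; it converges for all real $t$. With $f_i$ the number of $i$-dimensional faces of $\Delta$ ($f_{-1}=1$) and $d=\dim\Delta+1$, one has $E(S/I_\Delta;t)=\sum_{i=0}^d f_{i-1}(e^t-1)^i=e_0+e_1e^t+\dots+e_de^{dt}$, and $(e_0,\dots,e_d)$ is called the $e$-vector of $\Delta$; explicitly $e_k=\sum_{i=k}^d(-1)^{i-k}\binom{i}{k}f_{i-1}$.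 Hierarchical model: let $[r_i]=\{1,\dots,r_i\}$, $\mathcal{R}=\prod_{i=1}^m[r_i]$, and for $\sigma\subseteq[m]$ let $\mathcal{R}_\sigma=\prod_{f\in\sigma}[r_f]$; for $i\in\mathcal{R}$ let $i_\sigma=(i_f)_{f\in\sigma}$. The hierarchical log-linear model on $\Delta$ is the set of probability distributions $p$ on $\mathcal{R}$ with $p_i=\frac{1}{Z(\theta)}\prod_{\sigma\text{ facet of }\Delta}\theta^{(\sigma)}_{i_\sigma}$ for positive parameters $\theta^{(\sigma)}_j$ ($j\in\mathcal{R}_\sigma$) and normalizing constant $Z(\theta)$. The matrix $A_\Delta$ is the $\{0,1\}$-matrix describing this parametrization: columns are indexed by $i\in\mathcal{R}$, rows by pairs $(\sigma,j)$ with $\sigma$ a facet of $\Delta$ and $j\in\mathcal{R}_\sigma$, and the entry in row $(\sigma,j)$, column $i$ is $1$ if $i_\sigma=j$ and $0$ otherwise. Rank is over $\mathbb{Q}$. *)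

theory Defs
  imports
    "HOL-Analysis.Analysis"
    "HOL-Library.Poly_Mapping"
    "HOL-Library.Function_Algebras"
    "HOL-Algebra.Embedded_Algebras"
    "HOL-Algebra.QuotRing"
begin

text \<open>Faces are vertex sets and the empty set is a face.  An element of [m] need not be a
  vertex of the complex.\<close>

definition simplicial_complex_on :: "nat \<Rightarrow> nat set set \<Rightarrow> bool" where
  "simplicial_complex_on m \<Delta> \<longleftrightarrow>
     \<Delta> \<subseteq> Pow {1..m} \<and> {} \<in> \<Delta> \<and> (\<forall>\<sigma>\<in>\<Delta>. \<forall>\<tau>. \<tau> \<subseteq> \<sigma> \<longrightarrow> \<tau> \<in> \<Delta>)"

definition facets :: "nat set set \<Rightarrow> nat set set" where
  "facets \<Delta> = {\<sigma>\<in>\<Delta>. \<forall>\<tau>\<in>\<Delta>. \<sigma> \<subseteq> \<tau> \<longrightarrow> \<tau> = \<sigma>}"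

definition face_dim :: "nat set \<Rightarrow> int" where
  "face_dim \<sigma> = int (card \<sigma>) - 1"

definition complex_dim :: "nat set set \<Rightarrow> int" where
  "complex_dim \<Delta> = Max (face_dim ` \<Delta>)"

definition f_number :: "nat set set \<Rightarrow> int \<Rightarrow> nat" where
  "f_number \<Delta> i = card {\<sigma>\<in>\<Delta>. face_dim \<sigma> = i}"

text \<open>The coefficient of exp (k t) in the expansion of the f-polynomial at exp t - 1, that is,
  in the sum of the f_{i-1} (exp t - 1)^i over i = 0..d with d = dim + 1.\<close>

definition e_number :: "nat set set \<Rightarrow> nat \<Rightarrow> int" where
  "e_number \<Delta> k =
     (\<Sum>i = k..nat (complex_dim \<Delta> + 1).
        (- 1) ^ (i - k) * int (i choose k) * int (f_number \<Delta> (int i - 1)))"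

text \<open>A polynomial is a finitely supported map from exponent vectors to coefficients, where an
  exponent vector is a finitely supported map from indices of variables to naturals.\<close>

type_synonym exponent = "nat \<Rightarrow>\<^sub>0 nat"
type_synonym 'k mpoly = "exponent \<Rightarrow>\<^sub>0 'k"

definition exponents :: "nat \<Rightarrow> exponent set" where
  "exponents m = {a. Poly_Mapping.keys a \<subseteq> {1..m}}"

definition poly_ring :: "nat \<Rightarrow> 'k::field mpoly ring" where
  "poly_ring m =
     \<lparr>carrier = {p. Poly_Mapping.keys p \<subseteq> exponents m},
      mult = (*), one = 1, zero = 0, add = (+)\<rparr>"

definition var :: "nat \<Rightarrow> 'k::field mpoly" where
  "var i = Poly_Mapping.single (Poly_Mapping.single i 1) 1"

definition stanley_reisner_ideal :: "nat \<Rightarrow> nat set set \<Rightarrow> 'k::field mpoly set" where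
  "stanley_reisner_ideal m \<Delta> =
     Idl\<^bsub>poly_ring m\<^esub> {\<Prod>i\<in>\<tau>. var i |\<tau>. \<tau> \<subseteq> {1..m} \<and> \<tau> \<notin> \<Delta>}"

text \<open>For an ideal I of S generated by monomials, the component of degree a of S/I is the image
  of the span of the monomial with exponent a; in particular, the component of degree 0 is the
  image of the field of constants.\<close>

definition quot_component ::
  "nat \<Rightarrow> 'k::field mpoly set \<Rightarrow> exponent \<Rightarrow> 'k mpoly set set" where
  "quot_component m I a = {I +>\<^bsub>poly_ring m\<^esub> Poly_Mapping.single a c |c. True}"

definition quot_scalars :: "nat \<Rightarrow> 'k::field mpoly set \<Rightarrow> 'k mpoly set set" where
  "quot_scalars m I = {I +>\<^bsub>poly_ring m\<^esub> Poly_Mapping.single 0 c |c. True}"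

definition hilbert_fun :: "nat \<Rightarrow> 'k::field mpoly set \<Rightarrow> exponent \<Rightarrow> nat" where
  "hilbert_fun m I a =
     ring.dim (poly_ring m Quot I) (quot_scalars m I) (quot_component m I a)"

definition exp_hilbert_series ::
  "nat \<Rightarrow> 'k::field mpoly set \<Rightarrow> (nat \<Rightarrow> real) \<Rightarrow> real" where
  "exp_hilbert_series m I x =
     (\<Sum>\<^sub>\<infinity>a\<in>exponents m.
        real (hilbert_fun m I a) *
        ((\<Prod>i = 1..m. x i ^ Poly_Mapping.lookup a i) /
         (\<Prod>i = 1..m. fact (Poly_Mapping.lookup a i))))"

definition exp_hilbert_complex ::
  "'k::field itself \<Rightarrow> nat \<Rightarrow> nat set set \<Rightarrow> real \<Rightarrow> real" where
  "exp_hilbert_complex K m \<Delta> t =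
     exp_hilbert_series m (stanley_reisner_ideal m \<Delta> :: 'k mpoly set) (\<lambda>_. t)"

definition states :: "(nat \<Rightarrow> nat) \<Rightarrow> nat set \<Rightarrow> (nat \<Rightarrow> nat) set" where
  "states r \<sigma> = (\<Pi>\<^sub>E f\<in>\<sigma>. {1..r f})"

definition model_rows :: "nat set set \<Rightarrow> (nat \<Rightarrow> nat) \<Rightarrow> (nat set \<times> (nat \<Rightarrow> nat)) set" where
  "model_rows \<Delta> r = (SIGMA \<sigma>:facets \<Delta>. states r \<sigma>)"

definition model_columns :: "nat \<Rightarrow> (nat \<Rightarrow> nat) \<Rightarrow> (nat \<Rightarrow> nat) set" where
  "model_columns m r = states r {1..m}"

definition model_entry :: "nat set \<times> (nat \<Rightarrow> nat) \<Rightarrow> (nat \<Rightarrow> nat) \<Rightarrow> rat" where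
  "model_entry = (\<lambda>(\<sigma>, j) i. if restrict i \<sigma> = j then 1 else 0)"

text \<open>The rank of a matrix with row index set X and column index set Y is the dimension of its
  column space.  Columns are extended by 0 outside X, so that they all live in one function
  space.\<close>

definition matrix_rank :: "'x set \<Rightarrow> 'y set \<Rightarrow> ('x \<Rightarrow> 'y \<Rightarrow> 'f::field) \<Rightarrow> nat" where
  "matrix_rank X Y A =
     vector_space.dim (\<lambda>(c::'f) (v::'x \<Rightarrow> 'f) x. c * v x)
       ((\<lambda>y x. if x \<in> X then A x y else 0) ` Y)"

end

theory Submission
  imports Defs
begin

text \<open>
  Both quantities are evaluated as sums over the faces of \<open>\<Delta>\<close>, for arbitrary
  state space sizes and for the multigraded series; setting all sizes equal to \<open>r\<close> and all
  variables equal to \<open>ln r\<close> then makes the two sums agree term by term.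

  \<^emph>\<open>Rank.\<close> Let the support of a state \<open>y\<close> be the set of vertices \<open>f\<close> with \<open>y f \<noteq> 1\<close>.
  The columns of \<open>A\<close> at the states whose support is a face form a basis of the column space.
  They span: if the support \<open>T\<close> of \<open>y\<close> is not a face, then every facet misses a vertex of
  \<open>T\<close>, so every row is blind to one of the coordinates in \<open>T\<close>, and the alternating sum of the
  columns at the states obtained from \<open>y\<close> by resetting the coordinates outside a subset of \<open>T\<close>
  to 1 vanishes (\<open>nonface_column_relation\<close>).  This expresses the column at \<open>y\<close> by columns of
  strictly smaller support.  They are independent: if the support \<open>\<tau>\<close> of \<open>y\<close> is a face,
  rows of a facet containing \<open>\<tau>\<close> add up to the row that tests for agreement with \<open>y\<close> on
  \<open>\<tau>\<close>, and \<open>y\<close> is the only state of support no larger than \<open>\<tau>\<close> that passes this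
  test (\<open>face_columns_independent\<close>).  A face \<open>\<sigma>\<close> is the support of the product of the
  numbers \<open>r\<^sub>f - 1\<close> over \<open>f \<in> \<sigma>\<close> many states, whence \<open>rank_hierarchical_model\<close>.

  \<^emph>\<open>Series.\<close> A monomial is nonzero in the Stanley-Reisner ring exactly if its support is a face
  (\<open>monomial_in_stanley_reisner_ideal_iff\<close>), so the Hilbert function is the indicator of this
  condition.  Grouping the exponents by their support \<open>\<sigma>\<close> factors the series into the
  exponential series without their constant terms, that is, into the product of
  \<open>exp x\<^sub>i - 1\<close> over \<open>i \<in> \<sigma>\<close> (\<open>exp_hilbert_series_stanley_reisner\<close>).

  \<^emph>\<open>The e-vector.\<close> Expanding \<open>(r - 1)\<^sup>i\<close> by the binomial theorem rewrites the sum of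
  \<open>(r - 1)\<close> to the power \<open>card \<sigma>\<close> as a polynomial in \<open>r\<close>, whose coefficients are the
  entries of the e-vector (\<open>f_polynomial_eq_e_polynomial\<close>).
\<close>

section \<open>Simplicial complexes\<close>

lemma simplicial_complex_onD:
  assumes "simplicial_complex_on m \<Delta>"
  shows "finite \<Delta>" "{} \<in> \<Delta>" "\<sigma> \<in> \<Delta> \<Longrightarrow> \<sigma> \<subseteq> {1..m}"
    "\<sigma> \<in> \<Delta> \<Longrightarrow> \<tau> \<subseteq> \<sigma> \<Longrightarrow> \<tau> \<in> \<Delta>"
proof -
  have sub: "\<Delta> \<subseteq> Pow {1..m}" using assms unfolding simplicial_complex_on_def by blast
  then show "finite \<Delta>" by (rule finite_subset) simp
  show "\<sigma> \<in> \<Delta> \<Longrightarrow> \<sigma> \<subseteq> {1..m}" using sub by blast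
qed (use assms in \<open>auto simp: simplicial_complex_on_def\<close>)

lemma face_subset_facet:
  assumes "finite \<Delta>" "\<tau> \<in> \<Delta>"
  obtains \<sigma> where "\<sigma> \<in> facets \<Delta>" "\<tau> \<subseteq> \<sigma>"
  using finite_has_maximal2[OF assms] unfolding facets_def by blast

section \<open>Matrix rank by triangular elimination\<close>

text \<open>A column outside \<open>B\<close> is eliminated in favour of columns of smaller measure \<open>\<mu>\<close>, so that
  by induction all columns lie in the span of those in \<open>B\<close>.  The eliminating columns are a family
  \<open>z\<close> over an arbitrary index set \<open>I\<close> rather than a set, which spares its users an injectivity
  argument.\<close>

lemma matrix_rank_eq_card:
  fixes A :: "'x \<Rightarrow> 'y \<Rightarrow> 'f::field" and \<mu> :: "'y \<Rightarrow> nat"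
  assumes "finite B" "B \<subseteq> Y"
    and elim: "\<And>y. y \<in> Y - B \<Longrightarrow> \<exists>(I::'i set) z c. (\<forall>i\<in>I. z i \<in> Y \<and> \<mu> (z i) < \<mu> y) \<and>
                 (\<forall>x\<in>X. A x y = (\<Sum>i\<in>I. c i * A x (z i)))"
    and indep: "\<And>c. \<forall>x\<in>X. (\<Sum>b\<in>B. c b * A x b) = 0 \<Longrightarrow> \<forall>b\<in>B. c b = 0"
  shows "matrix_rank X Y A = card B"
proof -
  define col where "col = (\<lambda>y x. if x \<in> X then A x y else 0)"
  interpret V: vector_space "\<lambda>(c::'f) (v::'x \<Rightarrow> 'f) x. c * v x"
    by unfold_locales (auto simp: fun_eq_iff algebra_simps)
  have sum_apply: "(\<Sum>i\<in>I. g i) x = (\<Sum>i\<in>I. g i x)" for I :: "'j set" and g :: "'j \<Rightarrow> 'x \<Rightarrow> 'f" and x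
    by (induction I rule: infinite_finite_induct) auto
  \<comment> \<open>Two equal columns would give the relation with coefficients 1 and -1.\<close>
  have inj: "inj_on col B"
  proof (rule inj_onI, rule ccontr)
    fix a b assume ab: "a \<in> B" "b \<in> B" "col a = col b" "a \<noteq> b"
    let ?c = "\<lambda>y. (if y = a then 1 else 0) - (if y = b then 1 else 0) :: 'f"
    have "\<forall>x\<in>X. (\<Sum>y\<in>B. ?c y * A x y) = 0"
    proof
      fix x assume "x \<in> X"
      then have "A x a = A x b"
        using fun_cong[OF \<open>col a = col b\<close>, of x] by (simp add: col_def)
      then show "(\<Sum>y\<in>B. ?c y * A x y) = 0"
        using ab \<open>finite B\<close>
        by (simp add: left_diff_distrib sum_subtractf if_distrib[of "\<lambda>u. u * _"] cong: if_cong)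
    qed
    from indep[OF this] ab show False by auto
  qed
  have "V.independent (col ` B)"
  proof (rule V.independent_if_scalars_zero)
    fix f v assume sum0: "(\<Sum>v\<in>col ` B. (\<lambda>x. f v * v x)) = 0" and "v \<in> col ` B"
    then obtain b where b: "b \<in> B" "v = col b" by auto
    have "\<forall>x\<in>X. (\<Sum>b\<in>B. f (col b) * A x b) = 0"
    proof
      fix x assume "x \<in> X"
      have "(\<Sum>b\<in>B. f (col b) * col b x) = 0"
        using fun_cong[OF sum0, of x] by (simp add: sum_apply sum.reindex[OF inj])
      then show "(\<Sum>b\<in>B. f (col b) * A x b) = 0"
        using \<open>x \<in> X\<close> by (simp add: col_def)
    qed
    from indep[OF this] b show "f v = 0" by auto
  qed (use \<open>finite B\<close> in simp)
  moreover have "col y \<in> V.span (col ` B)" if "y \<in> Y" for y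
    using that
  proof (induction "\<mu> y" arbitrary: y rule: less_induct)
    case less
    show ?case
    proof (cases "y \<in> B")
      case True
      then show ?thesis by (simp add: V.span_base)
    next
      case False
      with elim[of y] less.prems obtain I :: "'i set" and z c
        where z: "\<And>i. i \<in> I \<Longrightarrow> z i \<in> Y \<and> \<mu> (z i) < \<mu> y"
          and eq: "\<And>x. x \<in> X \<Longrightarrow> A x y = (\<Sum>i\<in>I. c i * A x (z i))" by blast
      have "col y = (\<Sum>i\<in>I. (\<lambda>x. c i * col (z i) x))"
        by (auto simp: fun_eq_iff sum_apply col_def eq)
      also have "\<dots> \<in> V.span (col ` B)"
        using less.hyps z by (intro V.span_sum V.span_scale) auto
      finally show ?thesis .
    qed
  qed
  then have "V.span (col ` B) = V.span (col ` Y)"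
    using \<open>B \<subseteq> Y\<close> by (intro V.span_eq[THEN iffD2]) (auto intro: V.span_base)
  ultimately have "V.dim (col ` Y) = card (col ` B)"
    by (intro V.dim_eq_card)
  then show ?thesis
    using card_image[OF inj] unfolding matrix_rank_def col_def by simp
qed

section \<open>The rank of the hierarchical model\<close>

text \<open>The sign of a subset changes when \<open>f\<close> is inserted while the value of \<open>g\<close> does not, so the
  subsets without \<open>f\<close> cancel against those with \<open>f\<close>.\<close>

lemma sum_Pow_alternating_eq_0:
  fixes g :: "'a set \<Rightarrow> 'b::comm_ring_1"
  assumes "finite T" "f \<in> T" and invariant: "\<And>\<rho>. \<rho> \<subseteq> T - {f} \<Longrightarrow> g (insert f \<rho>) = g \<rho>"
  shows "(\<Sum>\<rho>\<in>Pow T. (- 1) ^ card \<rho> * g \<rho>) = 0"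
proof -
  let ?P = "Pow (T - {f})"
  have Pow: "Pow T = ?P \<union> insert f ` ?P"
    using \<open>f \<in> T\<close> Pow_insert[of f "T - {f}"] by (simp add: insert_absorb)
  have inj: "inj_on (insert f) ?P" by (auto simp: inj_on_def)
  have "(\<Sum>\<rho>\<in>Pow T. (- 1) ^ card \<rho> * g \<rho>) =
      (\<Sum>\<rho>\<in>?P. (- 1) ^ card \<rho> * g \<rho>) + (\<Sum>\<rho>\<in>?P. (- 1) ^ card (insert f \<rho>) * g (insert f \<rho>))"
    unfolding Pow using \<open>finite T\<close>
    by (subst sum.union_disjoint) (auto simp: sum.reindex[OF inj])
  also have "(\<Sum>\<rho>\<in>?P. (- 1) ^ card (insert f \<rho>) * g (insert f \<rho>)) =
      (\<Sum>\<rho>\<in>?P. - ((- 1) ^ card \<rho> * g \<rho>))"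
  proof (rule sum.cong)
    fix \<rho> assume "\<rho> \<in> ?P"
    moreover from this have "finite \<rho>" using \<open>finite T\<close> by (auto intro: finite_subset)
    moreover have "f \<notin> \<rho>" using \<open>\<rho> \<in> ?P\<close> by auto
    ultimately show "(- 1) ^ card (insert f \<rho>) * g (insert f \<rho>) = - ((- 1) ^ card \<rho> * g \<rho>)"
      by (simp add: invariant)
  qed simp
  finally show ?thesis by (simp add: sum_negf)
qed

text \<open>The state 1 of each vertex serves as the base state; every vertex has it, because the state
  spaces are nonempty.\<close>

definition state_support :: "nat \<Rightarrow> (nat \<Rightarrow> nat) \<Rightarrow> nat set" where
  "state_support m y = {f \<in> {1..m}. y f \<noteq> 1}"

definition reset_outside :: "nat \<Rightarrow> nat set \<Rightarrow> (nat \<Rightarrow> nat) \<Rightarrow> nat \<Rightarrow> nat" where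
  "reset_outside m \<rho> y = (\<lambda>f\<in>{1..m}. if f \<in> \<rho> then y f else 1)"

lemma state_support_subset: "state_support m y \<subseteq> {1..m}"
  by (auto simp: state_support_def)

lemma model_columns_with_support:
  assumes "\<sigma> \<subseteq> {1..m}" "\<forall>f\<in>{1..m}. 0 < rs f"
  shows "{y \<in> model_columns m rs. state_support m y = \<sigma>} =
    (\<Pi>\<^sub>E f\<in>{1..m}. if f \<in> \<sigma> then {2..rs f} else {1})" (is "?L = ?R")
proof (rule Set.set_eqI)
  fix y
  have "y \<in> ?L \<longleftrightarrow> y \<in> extensional {1..m} \<and>
      (\<forall>f\<in>{1..m}. y f \<in> {1..rs f} \<and> (f \<in> \<sigma> \<longleftrightarrow> y f \<noteq> 1))"
    using assms(1) unfolding model_columns_def states_def PiE_def Pi_def state_support_def by blast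
  also have "\<dots> \<longleftrightarrow> y \<in> extensional {1..m} \<and>
      (\<forall>f\<in>{1..m}. y f \<in> (if f \<in> \<sigma> then {2..rs f} else {1}))"
  proof (intro conj_cong refl ball_cong)
    fix f assume "f \<in> {1..m}"
    then have "0 < rs f" using assms(2) by blast
    then show "(y f \<in> {1..rs f} \<and> (f \<in> \<sigma> \<longleftrightarrow> y f \<noteq> 1)) \<longleftrightarrow>
        y f \<in> (if f \<in> \<sigma> then {2..rs f} else {1})" by auto
  qed
  also have "\<dots> \<longleftrightarrow> y \<in> ?R" unfolding PiE_def Pi_def by blast
  finally show "y \<in> ?L \<longleftrightarrow> y \<in> ?R" .
qed

lemma finite_model_columns: "finite (model_columns m rs)"
  unfolding model_columns_def states_def by (intro finite_PiE) auto

lemma card_face_columns: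
  assumes "simplicial_complex_on m \<Delta>" "\<forall>f\<in>{1..m}. 0 < rs f"
  shows "card {y \<in> model_columns m rs. state_support m y \<in> \<Delta>} = (\<Sum>\<sigma>\<in>\<Delta>. \<Prod>f\<in>\<sigma>. rs f - 1)"
proof -
  let ?C = "\<lambda>\<sigma>. {y \<in> model_columns m rs. state_support m y = \<sigma>}"
  have "{y \<in> model_columns m rs. state_support m y \<in> \<Delta>} = (\<Union>\<sigma>\<in>\<Delta>. ?C \<sigma>)" by auto
  also have "card \<dots> = (\<Sum>\<sigma>\<in>\<Delta>. card (?C \<sigma>))"
    using simplicial_complex_onD(1)[OF assms(1)] finite_model_columns
    by (intro card_UN_disjoint) auto
  also have "\<dots> = (\<Sum>\<sigma>\<in>\<Delta>. \<Prod>f\<in>\<sigma>. rs f - 1)"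
  proof (rule sum.cong)
    fix \<sigma> assume "\<sigma> \<in> \<Delta>"
    then have \<sigma>: "\<sigma> \<subseteq> {1..m}" by (rule simplicial_complex_onD(3)[OF assms(1)])
    have "card (?C \<sigma>) = (\<Prod>f\<in>{1..m}. if f \<in> \<sigma> then rs f - 1 else 1)"
      unfolding model_columns_with_support[OF \<sigma> assms(2)] card_PiE[OF finite_atLeastAtMost]
      by (intro prod.cong) auto
    also have "\<dots> = (\<Prod>f\<in>\<sigma>. rs f - 1)"
      using \<sigma> by (intro prod.mono_neutral_cong_right) auto
    finally show "card (?C \<sigma>) = (\<Prod>f\<in>\<sigma>. rs f - 1)" .
  qed simp
  finally show ?thesis .
qed

lemma reset_outside_column:
  assumes "y \<in> model_columns m rs" "\<forall>f\<in>{1..m}. 0 < rs f"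
  shows "reset_outside m \<rho> y \<in> model_columns m rs"
  using assms by (auto simp: model_columns_def states_def reset_outside_def PiE_def Pi_def Suc_le_eq)

lemma state_support_reset_outside:
  "\<rho> \<subseteq> state_support m y \<Longrightarrow> state_support m (reset_outside m \<rho> y) = \<rho>"
  by (auto simp: state_support_def reset_outside_def)

lemma reset_outside_support:
  "y \<in> model_columns m rs \<Longrightarrow> reset_outside m (state_support m y) y = y"
  by (auto simp: fun_eq_iff state_support_def reset_outside_def model_columns_def states_def
      PiE_def extensional_def)

lemma finite_state_support: "finite (state_support m y)"
  by (simp add: state_support_def)

text \<open>A nonface \<open>T\<close> is not contained in the facet \<open>\<sigma>\<close> of the row; a vertex
  \<open>f \<in> T - \<sigma>\<close> can be moved into or out of \<open>\<rho>\<close> without changing the entry at the reset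
  state, so \<open>sum_Pow_alternating_eq_0\<close> applies.  The relation below is that alternating sum,
  solved for the summand \<open>\<rho> = T\<close>, which belongs to \<open>y\<close> itself.\<close>

lemma nonface_column_relation:
  assumes y: "y \<in> model_columns m rs" and nonface: "state_support m y \<notin> \<Delta>"
    and \<Delta>: "simplicial_complex_on m \<Delta>" and x: "x \<in> model_rows \<Delta> rs"
  shows "model_entry x y =
    (\<Sum>\<rho>\<in>Pow (state_support m y) - {state_support m y}.
       - ((- 1) ^ card (state_support m y) * (- 1) ^ card \<rho>) * model_entry x (reset_outside m \<rho> y))"
proof -
  define T where "T = state_support m y"
  define g where "g = (\<lambda>\<rho>. model_entry x (reset_outside m \<rho> y))"
  obtain \<sigma> j where \<sigma>: "x = (\<sigma>, j)" "\<sigma> \<in> \<Delta>"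
    using x unfolding model_rows_def facets_def by blast
  obtain f where f: "f \<in> T" "f \<notin> \<sigma>"
    using nonface simplicial_complex_onD(4)[OF \<Delta> \<sigma>(2)] unfolding T_def by blast
  have "restrict (reset_outside m (insert f \<rho>) y) \<sigma> = restrict (reset_outside m \<rho> y) \<sigma>" for \<rho>
    using f by (auto simp: reset_outside_def fun_eq_iff)
  then have "(\<Sum>\<rho>\<in>Pow T. (- 1) ^ card \<rho> * g \<rho>) = 0"
    using f finite_state_support
    by (intro sum_Pow_alternating_eq_0) (auto simp: g_def T_def \<sigma> model_entry_def)
  then have "(- 1) ^ card T * g T = - (\<Sum>\<rho>\<in>Pow T - {T}. (- 1) ^ card \<rho> * g \<rho>)"
    by (subst (asm) sum.remove[of _ T]) (auto simp: T_def finite_state_support eq_neg_iff_add_eq_0)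
  \<comment> \<open>The sign of \<open>T\<close> is its own inverse.\<close>
  then have "(- 1) ^ card T * ((- 1) ^ card T * g T) =
      (- 1) ^ card T * - (\<Sum>\<rho>\<in>Pow T - {T}. (- 1) ^ card \<rho> * g \<rho>)" by simp
  then have "g T = (\<Sum>\<rho>\<in>Pow T - {T}. - ((- 1) ^ card T * (- 1) ^ card \<rho>) * g \<rho>)"
    by (simp add: mult.assoc[symmetric] power_add[symmetric] sum_distrib_left sum_negf
        flip: mult_2)
  moreover have "g T = model_entry x y"
    unfolding g_def T_def reset_outside_support[OF y] ..
  ultimately show ?thesis unfolding T_def g_def by simp
qed

text \<open>The coefficients vanish from the largest supports downwards.  Adding the relations of the rows
  of a facet \<open>\<sigma> \<supseteq> \<tau>\<close> that agree with \<open>y\<close> on the support \<open>\<tau>\<close> of \<open>y\<close>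
  leaves the coefficients of the states that agree with \<open>y\<close> on \<open>\<tau>\<close>.  These are \<open>y\<close> and
  states of strictly larger support, whose coefficients are 0 already.\<close>

lemma face_columns_independent:
  fixes c :: "(nat \<Rightarrow> nat) \<Rightarrow> rat" and rs :: "nat \<Rightarrow> nat"
  assumes \<Delta>: "simplicial_complex_on m \<Delta>"
  defines "B \<equiv> {y \<in> model_columns m rs. state_support m y \<in> \<Delta>}"
  assumes rel: "\<forall>x\<in>model_rows \<Delta> rs. (\<Sum>z\<in>B. c z * model_entry x z) = 0" and y: "y \<in> B"
  shows "c y = 0"
  using y
proof (induction "m - card (state_support m y)" arbitrary: y rule: less_induct)
  case less
  define \<tau> where "\<tau> = state_support m y"
  have "finite B" unfolding B_def using finite_model_columns by simp
  have \<tau>: "\<tau> \<in> \<Delta>" using less.prems by (simp add: B_def \<tau>_def)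
  then obtain \<sigma> where \<sigma>: "\<sigma> \<in> facets \<Delta>" "\<tau> \<subseteq> \<sigma>"
    using face_subset_facet simplicial_complex_onD(1)[OF \<Delta>] by blast
  then have \<sigma>m: "\<sigma> \<subseteq> {1..m}" using simplicial_complex_onD(3)[OF \<Delta>] by (auto simp: facets_def)
  let ?J = "{j \<in> states rs \<sigma>. \<forall>f\<in>\<tau>. j f = y f}"
  have "finite ?J" unfolding states_def
    by (rule finite_subset[of _ "\<Pi>\<^sub>E f\<in>\<sigma>. {1..rs f}"])
      (use \<sigma>m in \<open>auto intro!: finite_PiE intro: finite_subset\<close>)
  have row: "(\<Sum>j\<in>?J. model_entry (\<sigma>, j) z) = (if \<forall>f\<in>\<tau>. z f = y f then 1 else 0)"
    if "z \<in> B" for z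
  proof -
    have z: "restrict z \<sigma> \<in> states rs \<sigma>"
      using that \<sigma>m by (auto simp: B_def model_columns_def states_def PiE_def Pi_def)
    have "(\<Sum>j\<in>?J. model_entry (\<sigma>, j) z) = (if restrict z \<sigma> \<in> ?J then 1 else 0)"
      using \<open>finite ?J\<close> by (simp add: model_entry_def)
    also have "restrict z \<sigma> \<in> ?J \<longleftrightarrow> (\<forall>f\<in>\<tau>. z f = y f)"
      using z \<sigma>(2) by auto
    finally show ?thesis .
  qed
  have "0 = (\<Sum>j\<in>?J. \<Sum>z\<in>B. c z * model_entry (\<sigma>, j) z)"
    using rel \<sigma>(1) by (simp add: model_rows_def)
  also have "\<dots> = (\<Sum>z\<in>B. c z * (\<Sum>j\<in>?J. model_entry (\<sigma>, j) z))"
    by (subst sum.swap) (simp add: sum_distrib_left)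
  also have "\<dots> = (\<Sum>z\<in>B. if z = y then c z else 0)"
  proof (rule sum.cong)
    fix z assume z: "z \<in> B"
    have "c z = 0" if agree: "\<forall>f\<in>\<tau>. z f = y f" and "z \<noteq> y"
    proof -
      have sub: "\<tau> \<subseteq> state_support m z" using agree by (auto simp: \<tau>_def state_support_def)
      have "\<tau> \<noteq> state_support m z"
      proof
        assume eq: "\<tau> = state_support m z"
        have "z f = y f" for f
        proof (cases "f \<in> {1..m}")
          case True
          have "z f = 1 \<and> y f = 1" if "f \<notin> \<tau>"
            using that eq True unfolding \<tau>_def state_support_def by blast
          with agree show ?thesis by (cases "f \<in> \<tau>") auto
        next
          case False
          with z less.prems show ?thesis
            unfolding B_def model_columns_def states_def PiE_def extensional_def by auto
        qed
        with \<open>z \<noteq> y\<close> show False by blast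
      qed
      with sub have "card \<tau> < card (state_support m z)"
        by (intro psubset_card_mono finite_state_support) auto
      moreover have "card (state_support m z) \<le> m"
        using card_mono[of "{1..m}" "state_support m z"] state_support_subset by simp
      ultimately show "c z = 0" using less.hyps[OF _ z] by (simp add: \<tau>_def)
    qed
    then show "c z * (\<Sum>j\<in>?J. model_entry (\<sigma>, j) z) = (if z = y then c z else 0)"
      unfolding row[OF z] by auto
  qed simp
  also have "\<dots> = c y" using \<open>finite B\<close> less.prems by simp
  finally show ?case by simp
qed

text \<open>The rank counts the states whose support is a face.\<close>

theorem rank_hierarchical_model:
  assumes \<Delta>: "simplicial_complex_on m \<Delta>" and pos: "\<forall>f\<in>{1..m}. 0 < rs f"
  shows "matrix_rank (model_rows \<Delta> rs) (model_columns m rs) model_entry =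
    (\<Sum>\<sigma>\<in>\<Delta>. \<Prod>f\<in>\<sigma>. rs f - 1)"
proof -
  let ?B = "{y \<in> model_columns m rs. state_support m y \<in> \<Delta>}"
  have "matrix_rank (model_rows \<Delta> rs) (model_columns m rs) model_entry = card ?B"
  proof (rule matrix_rank_eq_card[where \<mu> = "\<lambda>y. card (state_support m y)" and 'i = "nat set"])
    fix y assume "y \<in> model_columns m rs - ?B"
    then have y: "y \<in> model_columns m rs" "state_support m y \<notin> \<Delta>" by auto
    let ?T = "state_support m y"
    show "\<exists>(I::nat set set) z c.
        (\<forall>i\<in>I. z i \<in> model_columns m rs \<and> card (state_support m (z i)) < card ?T) \<and>
        (\<forall>x\<in>model_rows \<Delta> rs. model_entry x y = (\<Sum>i\<in>I. c i * model_entry x (z i)))"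
    proof (intro exI conjI ballI)
      fix \<rho> assume \<rho>: "\<rho> \<in> Pow ?T - {?T}"
      then show "reset_outside m \<rho> y \<in> model_columns m rs"
        using reset_outside_column[OF y(1) pos] by simp
      from \<rho> show "card (state_support m (reset_outside m \<rho> y)) < card ?T"
        using finite_state_support
        by (subst state_support_reset_outside) (auto intro!: psubset_card_mono)
    qed (rule nonface_column_relation[OF y \<Delta>])
  next
    fix c :: "(nat \<Rightarrow> nat) \<Rightarrow> rat"
    assume "\<forall>x\<in>model_rows \<Delta> rs. (\<Sum>b\<in>?B. c b * model_entry x b) = 0"
    then show "\<forall>b\<in>?B. c b = 0" using face_columns_independent[OF \<Delta>] by blast
  qed (use finite_model_columns in auto)
  then show ?thesis using card_face_columns[OF assms] by simp
qed

section \<open>The Stanley-Reisner ideal\<close>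

lemma zero_in_exponents: "0 \<in> exponents m"
  by (simp add: exponents_def)

lemma add_in_exponents: "a \<in> exponents m \<Longrightarrow> b \<in> exponents m \<Longrightarrow> a + b \<in> exponents m"
  using keys_add[of a b] by (auto simp: exponents_def)

lemma keys_le_add: "Poly_Mapping.keys b \<subseteq> Poly_Mapping.keys (a + b)" for a b :: exponent
  by (auto simp: in_keys_iff lookup_add)

lemma poly_ring_cring: "cring (poly_ring m :: 'k::field mpoly ring)"
proof (rule cringI)
  show "abelian_group (poly_ring m :: 'k mpoly ring)"
  proof (rule abelian_groupI)
    fix p :: "'k mpoly"
    assume "p \<in> carrier (poly_ring m)"
    then show "\<exists>q\<in>carrier (poly_ring m). q \<oplus>\<^bsub>poly_ring m\<^esub> p = \<zero>\<^bsub>poly_ring m\<^esub>"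
      by (intro bexI[of _ "- p"]) (auto simp: poly_ring_def in_keys_iff)
  qed (use keys_add in \<open>fastforce simp: poly_ring_def algebra_simps\<close>)+
  show "Group.comm_monoid (poly_ring m :: 'k mpoly ring)"
  proof (rule comm_monoidI)
    fix p q :: "'k mpoly"
    assume "p \<in> carrier (poly_ring m)" "q \<in> carrier (poly_ring m)"
    then show "p \<otimes>\<^bsub>poly_ring m\<^esub> q \<in> carrier (poly_ring m)"
      using keys_mult[of p q] add_in_exponents[of _ m] by (fastforce simp: poly_ring_def)
  qed (auto simp: poly_ring_def zero_in_exponents algebra_simps)
qed (auto simp: poly_ring_def algebra_simps)

lemma poly_ring_ring: "ring (poly_ring m :: 'k::field mpoly ring)"
  using poly_ring_cring by (rule cring.axioms(1))

lemma poly_ring_a_inv: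
  fixes p :: "'k::field mpoly"
  assumes "p \<in> carrier (poly_ring m)"
  shows "\<ominus>\<^bsub>poly_ring m\<^esub> p = - p"
proof -
  interpret ring "poly_ring m :: 'k mpoly ring" by (rule poly_ring_ring)
  have "- p \<in> carrier (poly_ring m)"
    using assms by (auto simp: poly_ring_def in_keys_iff)
  moreover have "- p \<oplus>\<^bsub>poly_ring m\<^esub> p = \<zero>\<^bsub>poly_ring m\<^esub>" by (simp add: poly_ring_def)
  ultimately show ?thesis using assms by (metis minus_equality)
qed

text \<open>The dimensions that define the Hilbert function are taken over the image of the constants in
  the quotient; dimensions are well defined only over a subfield.\<close>

lemma constants_subfield:
  "subfield {Poly_Mapping.single 0 c |c. True} (poly_ring m :: 'k::field mpoly ring)"
  (is "subfield ?K ?R")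
proof -
  interpret cring ?R by (rule poly_ring_cring)
  have sub: "?K \<subseteq> carrier ?R" by (auto simp: poly_ring_def zero_in_exponents split: if_splits)
  have "subring ?K ?R"
  proof (rule subringI[OF sub])
    show "\<one>\<^bsub>?R\<^esub> \<in> ?K" by (auto simp: poly_ring_def intro: exI[of _ 1])
  next
    fix p assume "p \<in> ?K"
    moreover from this sub have "\<ominus>\<^bsub>?R\<^esub> p = - p" by (intro poly_ring_a_inv) blast
    ultimately show "\<ominus>\<^bsub>?R\<^esub> p \<in> ?K" by (auto simp flip: single_uminus)
  next
    fix p q assume "p \<in> ?K" "q \<in> ?K"
    then obtain c d where "p = Poly_Mapping.single 0 c" "q = Poly_Mapping.single 0 d" by auto
    then show "p \<otimes>\<^bsub>?R\<^esub> q \<in> ?K" "p \<oplus>\<^bsub>?R\<^esub> q \<in> ?K"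
      by (auto simp: poly_ring_def mult_single simp flip: single_add)
  qed
  then have "subcring ?K ?R" by (rule subcringI')
  moreover have "Units (?R\<lparr>carrier := ?K\<rparr>) = ?K - {\<zero>\<^bsub>?R\<^esub>}" (is "?U = _")
  proof
    have "0 \<notin> ?U" by (auto simp: Units_def poly_ring_def)
    then show "?U \<subseteq> ?K - {\<zero>\<^bsub>?R\<^esub>}" by (auto simp: Units_def poly_ring_def)
    show "?K - {\<zero>\<^bsub>?R\<^esub>} \<subseteq> ?U"
    proof
      fix p assume "p \<in> ?K - {\<zero>\<^bsub>?R\<^esub>}"
      then obtain c where c: "p = Poly_Mapping.single 0 c" "c \<noteq> 0"
        by (auto simp: poly_ring_def) (metis single_zero)
      then have "p * Poly_Mapping.single 0 (inverse c) = 1"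
        by (simp add: mult_single)
      then show "p \<in> ?U"
        unfolding Units_def poly_ring_def
        by (intro CollectI conjI bexI[of _ "Poly_Mapping.single 0 (inverse c)"])
          (auto simp: c mult.commute)
    qed
  qed
  ultimately show ?thesis by (rule subfieldI)
qed

text \<open>This ideal bounds the Stanley-Reisner ideal from above: the support of a product of monomials
  contains the support of each factor, and a set containing a nonface is a nonface.\<close>

lemma nonface_support_ideal:
  assumes \<Delta>: "simplicial_complex_on m \<Delta>"
  shows "ideal {p. Poly_Mapping.keys p \<subseteq> exponents m \<and> (\<forall>a\<in>Poly_Mapping.keys p. Poly_Mapping.keys a \<notin> \<Delta>)}
    (poly_ring m :: 'k::field mpoly ring)" (is "ideal ?J ?R")
proof -
  interpret cring ?R by (rule poly_ring_cring)
  have l_closed: "x * p \<in> ?J" if "p \<in> ?J" "x \<in> carrier ?R" for p x :: "'k mpoly"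
  proof -
    have "Poly_Mapping.keys e \<notin> \<Delta> \<and> e \<in> exponents m" if e: "e \<in> Poly_Mapping.keys (x * p)" for e
    proof -
      obtain a b where "e = a + b" "a \<in> Poly_Mapping.keys x" "b \<in> Poly_Mapping.keys p"
        using e keys_mult[of x p] by blast
      moreover from this \<open>p \<in> ?J\<close> \<open>x \<in> carrier ?R\<close>
      have "Poly_Mapping.keys b \<notin> \<Delta>" "a \<in> exponents m" "b \<in> exponents m"
        by (auto simp: poly_ring_def)
      ultimately show ?thesis
        using keys_le_add[of b a] simplicial_complex_onD(4)[OF \<Delta>] add_in_exponents by blast
    qed
    then show ?thesis by auto
  qed
  show ?thesis
  proof (rule idealI)
    show "subgroup ?J (add_monoid ?R)"
    proof (rule add.subgroupI)
      show "?J \<subseteq> carrier ?R" by (auto simp: poly_ring_def)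
      show "?J \<noteq> {}" by (auto intro: exI[of _ 0])
    next
      fix p assume p: "p \<in> ?J"
      then have "p \<in> carrier ?R" by (auto simp: poly_ring_def)
      from poly_ring_a_inv[OF this] p show "\<ominus>\<^bsub>?R\<^esub> p \<in> ?J" by (auto simp: in_keys_iff)
    next
      fix p q assume "p \<in> ?J" "q \<in> ?J"
      then show "p \<oplus>\<^bsub>?R\<^esub> q \<in> ?J" using keys_add[of p q] by (auto simp: poly_ring_def)
    qed
  next
    fix p x assume "p \<in> ?J" "x \<in> carrier ?R"
    from l_closed[OF this] show "x \<otimes>\<^bsub>?R\<^esub> p \<in> ?J" "p \<otimes>\<^bsub>?R\<^esub> x \<in> ?J"
      by (simp_all add: poly_ring_def mult.commute)
  qed (rule poly_ring_ring)
qed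

lemma prod_var:
  assumes "finite \<tau>"
  shows "(\<Prod>i\<in>\<tau>. var i :: 'k::field mpoly) =
    Poly_Mapping.single (\<Sum>i\<in>\<tau>. Poly_Mapping.single i 1) 1"
  using assms by (induction) (simp_all add: var_def mult_single)

lemma lookup_sum_single:
  assumes "finite \<tau>"
  shows "Poly_Mapping.lookup (\<Sum>i\<in>\<tau>. Poly_Mapping.single i (1::nat)) j = (if j \<in> \<tau> then 1 else 0)"
  using assms by (induction) (auto simp: lookup_add lookup_single when_def)

lemma keys_sum_single:
  assumes "finite \<tau>"
  shows "Poly_Mapping.keys (\<Sum>i\<in>\<tau>. Poly_Mapping.single i (1::nat)) = \<tau>"
  using lookup_sum_single[OF assms] by (auto simp: in_keys_iff split: if_splits)

lemma stanley_reisner_generators_in_carrier: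
  "{\<Prod>i\<in>\<tau>. var i |\<tau>. \<tau> \<subseteq> {1..m} \<and> \<tau> \<notin> \<Delta>} \<subseteq> carrier (poly_ring m :: 'k::field mpoly ring)"
proof clarify
  fix \<tau> assume "\<tau> \<subseteq> {1..m}"
  moreover from this have "finite \<tau>" by (rule finite_subset) simp
  ultimately show "(\<Prod>i\<in>\<tau>. var i) \<in> carrier (poly_ring m :: 'k mpoly ring)"
    using keys_sum_single[of \<tau>] by (simp add: prod_var poly_ring_def exponents_def)
qed

lemma stanley_reisner_ideal_ideal:
  "ideal (stanley_reisner_ideal m \<Delta>) (poly_ring m :: 'k::field mpoly ring)"
  unfolding stanley_reisner_ideal_def
  by (rule ring.genideal_ideal[OF poly_ring_ring stanley_reisner_generators_in_carrier])

text \<open>The ideal of \<open>nonface_support_ideal\<close> contains the generators, which gives one direction.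
  Conversely, a monomial whose support \<open>\<tau>\<close> is a nonface is a multiple of the generator of
  \<open>\<tau>\<close>.\<close>

lemma monomial_in_stanley_reisner_ideal_iff:
  fixes c :: "'k::field"
  assumes \<Delta>: "simplicial_complex_on m \<Delta>" and a: "a \<in> exponents m"
  shows "Poly_Mapping.single a c \<in> stanley_reisner_ideal m \<Delta> \<longleftrightarrow> c = 0 \<or> Poly_Mapping.keys a \<notin> \<Delta>"
    (is "?x \<in> ?I \<longleftrightarrow> _")
proof
  let ?J = "{p :: 'k mpoly. Poly_Mapping.keys p \<subseteq> exponents m \<and>
    (\<forall>a\<in>Poly_Mapping.keys p. Poly_Mapping.keys a \<notin> \<Delta>)}"
  assume "?x \<in> ?I"
  moreover have "?I \<subseteq> ?J"
    unfolding stanley_reisner_ideal_def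
  proof (rule ring.genideal_minimal[OF poly_ring_ring nonface_support_ideal[OF \<Delta>]], clarify)
    fix \<tau> assume \<tau>: "\<tau> \<subseteq> {1..m}" "\<tau> \<notin> \<Delta>"
    moreover from \<tau>(1) have "finite \<tau>" by (rule finite_subset) simp
    ultimately show "Poly_Mapping.keys (\<Prod>i\<in>\<tau>. var i :: 'k mpoly) \<subseteq> exponents m \<and>
        (\<forall>a\<in>Poly_Mapping.keys (\<Prod>i\<in>\<tau>. var i :: 'k mpoly). Poly_Mapping.keys a \<notin> \<Delta>)"
      using keys_sum_single[of \<tau>] by (simp add: prod_var exponents_def)
  qed
  ultimately have "?x \<in> ?J" by blast
  then show "c = 0 \<or> Poly_Mapping.keys a \<notin> \<Delta>" by (auto split: if_splits)
next
  interpret I: ideal ?I "poly_ring m :: 'k mpoly ring" by (rule stanley_reisner_ideal_ideal)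
  assume *: "c = 0 \<or> Poly_Mapping.keys a \<notin> \<Delta>"
  show "?x \<in> ?I"
  proof (cases "c = 0")
    case True
    then show ?thesis
      using additive_subgroup.zero_closed[OF I.is_additive_subgroup] by (simp add: poly_ring_def)
  next
    case False
    define \<tau> where "\<tau> = Poly_Mapping.keys a"
    define s where "s = (\<Sum>i\<in>\<tau>. Poly_Mapping.single i (1::nat))"
    have \<tau>: "\<tau> \<subseteq> {1..m}" "\<tau> \<notin> \<Delta>" "finite \<tau>"
      using False * a by (auto simp: \<tau>_def exponents_def)
    have "s + (a - s) = a"
      using lookup_sum_single[OF \<tau>(3)]
      by (intro poly_mapping_eqI) (auto simp: s_def \<tau>_def lookup_add lookup_minus in_keys_iff)
    then have "?x = Poly_Mapping.single (a - s) c * (\<Prod>i\<in>\<tau>. var i)"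
      unfolding prod_var[OF \<tau>(3)] s_def[symmetric] by (simp add: mult_single add.commute)
    moreover have "(\<Prod>i\<in>\<tau>. var i) \<in> ?I"
      unfolding stanley_reisner_ideal_def
      using ring.genideal_self[OF poly_ring_ring stanley_reisner_generators_in_carrier] \<tau> by blast
    moreover have "Poly_Mapping.keys (a - s) \<subseteq> Poly_Mapping.keys a"
      by (auto simp: in_keys_iff lookup_minus)
    then have "Poly_Mapping.single (a - s) c \<in> carrier (poly_ring m)"
      using a by (auto simp: poly_ring_def exponents_def)
    ultimately show ?thesis using I.I_l_closed by (simp add: poly_ring_def)
  qed
qed

section \<open>The Hilbert function\<close>

lemma (in ring) dim_line:
  assumes K: "subfield K R" and v: "v \<in> carrier R" "v \<noteq> \<zero>"
  shows "dim K {k \<otimes> v |k. k \<in> K} = 1"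
proof -
  have "dimension (Suc 0) K (line_extension K v {\<zero>})"
    using v by (intro Suc_dim) auto
  moreover have "line_extension K v {\<zero>} = {k \<otimes> v |k. k \<in> K}"
  proof (rule Set.set_eqI)
    fix u
    have "u \<in> line_extension K v {\<zero>} \<longleftrightarrow> (\<exists>k\<in>K. u = k \<otimes> v \<oplus> \<zero>)"
      by (simp add: line_extension_mem_iff)
    also have "\<dots> \<longleftrightarrow> (\<exists>k\<in>K. u = k \<otimes> v)"
      using v(1) subfieldE(3)[OF K] by (intro bex_cong) auto
    finally show "u \<in> line_extension K v {\<zero>} \<longleftrightarrow> u \<in> {k \<otimes> v |k. k \<in> K}" by blast
  qed
  ultimately show ?thesis using dimI[OF K] by (simp add: over_def)
qed

lemma (in ring) dim_zero: "subfield K R \<Longrightarrow> dim K {\<zero>} = 0"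
  using dimI[of K 0 "{\<zero>}"] by (simp add: over_def zero_dim)

text \<open>The component of degree \<open>a\<close> consists of the multiples of one residue class by constants, so
  its dimension is 1 or 0 according to whether this class is nonzero.  The quotient is not the zero
  ring because the empty set is a face; hence the image of the constants is a subfield.\<close>

lemma hilbert_fun_stanley_reisner:
  assumes \<Delta>: "simplicial_complex_on m \<Delta>" and a: "a \<in> exponents m"
  shows "hilbert_fun m (stanley_reisner_ideal m \<Delta> :: 'k::field mpoly set) a =
    (if Poly_Mapping.keys a \<in> \<Delta> then 1 else 0)"
proof -
  let ?R = "poly_ring m :: 'k mpoly ring"
  define I :: "'k mpoly set" where "I = stanley_reisner_ideal m \<Delta>"
  define h where "h = (+>\<^bsub>?R\<^esub>) I"
  interpret I: ideal I ?R unfolding I_def by (rule stanley_reisner_ideal_ideal)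
  interpret h: ring_hom_ring ?R "?R Quot I" h
    unfolding h_def by (rule I.rcos_ring_hom_ring)
  have mono: "Poly_Mapping.single b c \<in> carrier ?R" if "b \<in> exponents m" for b and c :: 'k
    using that by (simp add: poly_ring_def)
  have h_zero: "h (Poly_Mapping.single b c) = \<zero>\<^bsub>?R Quot I\<^esub> \<longleftrightarrow> c = 0 \<or> Poly_Mapping.keys b \<notin> \<Delta>"
    if b: "b \<in> exponents m" for b and c :: 'k
  proof -
    have "h (Poly_Mapping.single b c) = \<zero>\<^bsub>?R Quot I\<^esub> \<longleftrightarrow> Poly_Mapping.single b c \<in> I"
      using I.a_rcos_const[of "Poly_Mapping.single b c"] I.a_rcos_self[OF mono[OF b, of c]]
      unfolding h_def FactRing_def by fastforce
    then show ?thesis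
      unfolding I_def monomial_in_stanley_reisner_ideal_iff[OF \<Delta> b] .
  qed
  have "\<one>\<^bsub>?R Quot I\<^esub> \<noteq> \<zero>\<^bsub>?R Quot I\<^esub>"
    using h_zero[OF zero_in_exponents, of 1] h.hom_one simplicial_complex_onD(2)[OF \<Delta>]
    by (simp add: poly_ring_def)
  moreover have "quot_scalars m I = h ` {Poly_Mapping.single 0 c |c. True}"
    unfolding quot_scalars_def h_def by blast
  ultimately have K: "subfield (quot_scalars m I) (?R Quot I)"
    using h.img_is_subfield(2)[OF constants_subfield] by simp
  have "quot_component m I a =
      {k \<otimes>\<^bsub>?R Quot I\<^esub> h (Poly_Mapping.single a 1) |k. k \<in> quot_scalars m I}"
  proof -
    have factor: "h (Poly_Mapping.single a c) =
        h (Poly_Mapping.single 0 c) \<otimes>\<^bsub>?R Quot I\<^esub> h (Poly_Mapping.single a 1)" for c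
      using h.hom_mult[OF mono[OF zero_in_exponents] mono[OF a], of c 1]
      by (simp add: poly_ring_def mult_single)
    have "quot_component m I a = range (\<lambda>c. h (Poly_Mapping.single a c))"
      unfolding quot_component_def h_def by blast
    also have "\<dots> = range (\<lambda>c. h (Poly_Mapping.single 0 c) \<otimes>\<^bsub>?R Quot I\<^esub> h (Poly_Mapping.single a 1))"
      by (rule image_cong[OF refl factor])
    also have "\<dots> = {k \<otimes>\<^bsub>?R Quot I\<^esub> h (Poly_Mapping.single a 1) |k. k \<in> quot_scalars m I}"
      unfolding quot_scalars_def h_def by blast
    finally show ?thesis .
  qed
  moreover have "h (Poly_Mapping.single a 1) \<in> carrier (?R Quot I)"
    by (rule h.hom_closed[OF mono[OF a]])
  ultimately have one: "hilbert_fun m I a = 1" if "Poly_Mapping.keys a \<in> \<Delta>"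
    unfolding hilbert_fun_def using h.S.dim_line[OF K] h_zero[OF a, of 1] that by simp
  have zero: "hilbert_fun m I a = 0" if "Poly_Mapping.keys a \<notin> \<Delta>"
  proof -
    have "quot_component m I a = {\<zero>\<^bsub>?R Quot I\<^esub>}"
      using h_zero[OF a] that unfolding quot_component_def h_def by auto
    then show ?thesis
      unfolding hilbert_fun_def by (simp add: h.S.dim_zero[OF K])
  qed
  show ?thesis using one zero unfolding I_def by simp
qed

section \<open>The exponential Hilbert series\<close>

text \<open>Absolute summability of the factors makes the product family summable, so that the product
  formula for infinite sums becomes a statement about convergence.  Convergence is what allows
  finitely many such sums, one for each face, to be added up.\<close>

lemma has_sum_prod_PiE:
  fixes f :: "'a \<Rightarrow> 'b::countable \<Rightarrow> real"
  assumes "finite A" and f: "\<And>x. x \<in> A \<Longrightarrow> (\<lambda>n. norm (f x n)) summable_on B x"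
  shows "((\<lambda>g. \<Prod>x\<in>A. f x (g x)) has_sum (\<Prod>x\<in>A. infsum (f x) (B x))) (Pi\<^sub>E A B)"
proof -
  have "Infinite_Set_Sum.abs_summable_on (\<lambda>g. \<Prod>x\<in>A. f x (g x)) (Pi\<^sub>E A B)"
    using assms by (intro abs_summable_on_prod_PiE) (auto simp: abs_summable_equivalent[symmetric])
  then have "(\<lambda>g. \<Prod>x\<in>A. f x (g x)) summable_on (Pi\<^sub>E A B)"
    by (simp add: abs_summable_summable flip: abs_summable_equivalent)
  then show ?thesis
    using infsum_prod_PiE_abs[OF assms(1), of f B] f by (metis has_sum_infsum)
qed

lemma exp_minus_one_has_sum:
  fixes x :: real
  shows "((\<lambda>n. x ^ n / fact n) has_sum (exp x - 1)) {0<..}"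
    and "(\<lambda>n. norm (x ^ n / fact n)) summable_on {0<..}"
proof -
  have norm: "summable (\<lambda>n. norm (x ^ n / fact n))"
    using summable_norm_exp[of x] by (simp add: divide_inverse_commute)
  have "(\<lambda>n. x ^ n / fact n) sums exp x"
    using exp_converges[of x] by (simp add: divide_inverse_commute)
  then have "((\<lambda>n. x ^ n / fact n) has_sum exp x) UNIV"
    using norm by (rule norm_summable_imp_has_sum[rotated])
  then have "((\<lambda>n. x ^ n / fact n) has_sum (exp x - x ^ 0 / fact 0)) (UNIV - {0})"
    by (rule has_sum_Diff) (auto intro: has_sum_finiteI)
  moreover have "UNIV - {0} = {0::nat<..}" by auto
  ultimately show "((\<lambda>n. x ^ n / fact n) has_sum (exp x - 1)) {0<..}" by simp
  show "(\<lambda>n. norm (x ^ n / fact n)) summable_on {0<..}"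
    using norm summable_nonneg_imp_summable_on[OF norm] by (auto intro: summable_on_subset_banach)
qed

lemma bij_betw_exponents_with_support:
  assumes "finite \<sigma>"
  shows "bij_betw (\<lambda>a. restrict (Poly_Mapping.lookup a) \<sigma>) {a :: exponent. Poly_Mapping.keys a = \<sigma>}
    (\<Pi>\<^sub>E i\<in>\<sigma>. {0<..})"
proof (rule bij_betwI')
  fix a b :: exponent
  assume ab: "a \<in> {a. Poly_Mapping.keys a = \<sigma>}" "b \<in> {a. Poly_Mapping.keys a = \<sigma>}"
  show "(restrict (Poly_Mapping.lookup a) \<sigma> = restrict (Poly_Mapping.lookup b) \<sigma>) = (a = b)"
  proof
    assume eq: "restrict (Poly_Mapping.lookup a) \<sigma> = restrict (Poly_Mapping.lookup b) \<sigma>"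
    show "a = b"
    proof (rule poly_mapping_eqI)
      fix i
      show "Poly_Mapping.lookup a i = Poly_Mapping.lookup b i"
        using ab fun_cong[OF eq, of i] by (cases "i \<in> \<sigma>") (auto simp: in_keys_iff)
    qed
  qed simp
next
  fix a :: exponent assume "a \<in> {a. Poly_Mapping.keys a = \<sigma>}"
  then show "restrict (Poly_Mapping.lookup a) \<sigma> \<in> (\<Pi>\<^sub>E i\<in>\<sigma>. {0<..})"
    by (auto simp: in_keys_iff)
next
  fix g :: "nat \<Rightarrow> nat" assume g: "g \<in> (\<Pi>\<^sub>E i\<in>\<sigma>. {0<..})"
  let ?g = "\<lambda>i. if i \<in> \<sigma> then g i else 0"
  have "{i. ?g i \<noteq> 0} \<subseteq> \<sigma>" by auto
  with assms have lookup: "Poly_Mapping.lookup (Abs_poly_mapping ?g) = ?g"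
    by (intro lookup_Abs_poly_mapping) (rule finite_subset)
  have "Poly_Mapping.keys (Abs_poly_mapping ?g) = \<sigma>"
    using g by (auto simp: keys.rep_eq lookup PiE_def Pi_def split: if_splits)
  moreover have "g = restrict (Poly_Mapping.lookup (Abs_poly_mapping ?g)) \<sigma>"
    using g unfolding lookup by (auto simp: fun_eq_iff PiE_def extensional_def)
  ultimately show "\<exists>a\<in>{a. Poly_Mapping.keys a = \<sigma>}. g = restrict (Poly_Mapping.lookup a) \<sigma>" by auto
qed

text \<open>The exponents with support \<open>\<sigma>\<close> are the families of positive numbers indexed by
  \<open>\<sigma>\<close>, and vertices outside \<open>\<sigma>\<close> contribute the factor 1.\<close>

lemma has_sum_exponents_with_support:
  fixes x :: "nat \<Rightarrow> real"
  assumes "\<sigma> \<subseteq> {1..m}"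
  shows "((\<lambda>a. (\<Prod>i = 1..m. x i ^ Poly_Mapping.lookup a i) / (\<Prod>i = 1..m. fact (Poly_Mapping.lookup a i)))
    has_sum (\<Prod>i\<in>\<sigma>. exp (x i) - 1)) {a. Poly_Mapping.keys a = \<sigma>}"
proof -
  have fin: "finite \<sigma>" using assms by (rule finite_subset) simp
  have "((\<lambda>g. \<Prod>i\<in>\<sigma>. x i ^ g i / fact (g i)) has_sum
      (\<Prod>i\<in>\<sigma>. infsum (\<lambda>n. x i ^ n / fact n) {0<..})) (\<Pi>\<^sub>E i\<in>\<sigma>. {0<..})"
    by (intro has_sum_prod_PiE fin exp_minus_one_has_sum(2))
  also have "(\<Prod>i\<in>\<sigma>. infsum (\<lambda>n. x i ^ n / fact n) {0<..}) = (\<Prod>i\<in>\<sigma>. exp (x i) - 1)"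
    by (intro prod.cong refl infsumI exp_minus_one_has_sum(1))
  finally have "((\<lambda>a. \<Prod>i\<in>\<sigma>. x i ^ restrict (Poly_Mapping.lookup a) \<sigma> i /
      fact (restrict (Poly_Mapping.lookup a) \<sigma> i)) has_sum (\<Prod>i\<in>\<sigma>. exp (x i) - 1))
      {a. Poly_Mapping.keys a = \<sigma>}"
    by (subst has_sum_reindex_bij_betw[OF bij_betw_exponents_with_support[OF fin]])
  then show ?thesis
  proof (rule has_sum_cong[THEN iffD1, rotated])
    fix a :: exponent assume a: "a \<in> {a. Poly_Mapping.keys a = \<sigma>}"
    have "(\<Prod>i = 1..m. x i ^ Poly_Mapping.lookup a i) / (\<Prod>i = 1..m. fact (Poly_Mapping.lookup a i)) =
        (\<Prod>i = 1..m. x i ^ Poly_Mapping.lookup a i / fact (Poly_Mapping.lookup a i))"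
      by (simp add: prod_dividef)
    also have "\<dots> = (\<Prod>i\<in>\<sigma>. x i ^ Poly_Mapping.lookup a i / fact (Poly_Mapping.lookup a i))"
      using assms a by (intro prod.mono_neutral_right) (auto simp: in_keys_iff)
    finally show "(\<Prod>i\<in>\<sigma>. x i ^ restrict (Poly_Mapping.lookup a) \<sigma> i /
        fact (restrict (Poly_Mapping.lookup a) \<sigma> i)) =
      (\<Prod>i = 1..m. x i ^ Poly_Mapping.lookup a i) / (\<Prod>i = 1..m. fact (Poly_Mapping.lookup a i))"
      by (simp cong: prod.cong)
  qed
qed

theorem exp_hilbert_series_stanley_reisner:
  fixes x :: "nat \<Rightarrow> real"
  assumes \<Delta>: "simplicial_complex_on m \<Delta>"
  shows "exp_hilbert_series m (stanley_reisner_ideal m \<Delta> :: 'k::field mpoly set) x =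
    (\<Sum>\<sigma>\<in>\<Delta>. \<Prod>i\<in>\<sigma>. exp (x i) - 1)"
proof -
  let ?t = "\<lambda>a. (\<Prod>i = 1..m. x i ^ Poly_Mapping.lookup a i) / (\<Prod>i = 1..m. fact (Poly_Mapping.lookup a i))"
  let ?E = "\<Union>\<sigma>\<in>\<Delta>. {a :: exponent. Poly_Mapping.keys a = \<sigma>}"
  have "(?t has_sum (\<Sum>\<sigma>\<in>\<Delta>. \<Prod>i\<in>\<sigma>. exp (x i) - 1)) ?E"
    using simplicial_complex_onD(1,3)[OF \<Delta>]
    by (intro sum_has_sum has_sum_exponents_with_support) auto
  then have "infsum ?t ?E = (\<Sum>\<sigma>\<in>\<Delta>. \<Prod>i\<in>\<sigma>. exp (x i) - 1)" by (rule infsumI)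
  moreover have "exp_hilbert_series m (stanley_reisner_ideal m \<Delta> :: 'k mpoly set) x = infsum ?t ?E"
    unfolding exp_hilbert_series_def
    using simplicial_complex_onD(3)[OF \<Delta>]
    by (intro infsum_cong_neutral) (auto simp: hilbert_fun_stanley_reisner[OF \<Delta>] exponents_def)
  ultimately show ?thesis by simp
qed

section \<open>The e-vector\<close>

text \<open>Grouping the faces by cardinality gives the f-polynomial at \<open>q - 1\<close>; the binomial expansion
  of its powers and an exchange of the two summations give the e-numbers.\<close>

lemma f_polynomial_eq_e_polynomial:
  fixes q :: "'a::comm_ring_1"
  assumes \<Delta>: "simplicial_complex_on m \<Delta>"
  shows "(\<Sum>\<sigma>\<in>\<Delta>. (q - 1) ^ card \<sigma>) =
    (\<Sum>k = 0..nat (complex_dim \<Delta> + 1). of_int (e_number \<Delta> k) * q ^ k)"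
proof -
  define d where "d = nat (complex_dim \<Delta> + 1)"
  define F where "F = (\<lambda>i. {\<sigma>\<in>\<Delta>. card \<sigma> = i})"
  have "finite \<Delta>" by (rule simplicial_complex_onD(1)[OF \<Delta>])
  have f: "f_number \<Delta> (int i - 1) = card (F i)" for i
    by (simp add: f_number_def face_dim_def F_def)
  have card_le: "card \<sigma> \<le> d" if "\<sigma> \<in> \<Delta>" for \<sigma>
  proof -
    have "face_dim \<sigma> \<le> complex_dim \<Delta>"
      unfolding complex_dim_def using \<open>finite \<Delta>\<close> that by (intro Max_ge) auto
    then show ?thesis by (simp add: d_def face_dim_def)
  qed
  have "(\<Sum>\<sigma>\<in>\<Delta>. (q - 1) ^ card \<sigma>) = (\<Sum>i = 0..d. \<Sum>\<sigma>\<in>F i. (q - 1) ^ card \<sigma>)"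
    unfolding F_def using \<open>finite \<Delta>\<close> card_le by (subst sum.group) auto
  also have "\<dots> = (\<Sum>i = 0..d. of_nat (card (F i)) * (q - 1) ^ i)"
    by (intro sum.cong) (auto simp: F_def)
  also have "\<dots> = (\<Sum>i = 0..d. \<Sum>k = 0..i.
      of_nat (card (F i)) * (of_nat (i choose k) * q ^ k * (- 1) ^ (i - k)))"
    using binomial_ring[of q "- 1"] by (simp add: sum_distrib_left atLeast0AtMost)
  also have "\<dots> = (\<Sum>k = 0..d. \<Sum>i = k..d.
      of_nat (card (F i)) * (of_nat (i choose k) * q ^ k * (- 1) ^ (i - k)))"
  proof -
    have "{k \<in> {0..d}. k \<le> i} = {0..i}" if "i \<in> {0..d}" for i using that by auto
    moreover have "{i \<in> {0..d}. k \<le> i} = {k..d}" for k by auto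
    ultimately show ?thesis
      using sum.swap_restrict[of "{0..d}" "{0..d}" "\<lambda>i k. of_nat (card (F i)) *
        (of_nat (i choose k) * q ^ k * (- 1) ^ (i - k))" "\<lambda>i k. k \<le> i"] by simp
  qed
  also have "\<dots> = (\<Sum>k = 0..d. of_int (e_number \<Delta> k) * q ^ k)"
    unfolding e_number_def f d_def[symmetric]
    by (simp add: sum_distrib_left sum_distrib_right ac_simps)
  finally show ?thesis unfolding d_def .
qed

section \<open>Equal state space sizes\<close>

theorem proposition11:
  fixes m :: nat and \<Delta> :: "nat set set" and rs :: "nat \<Rightarrow> nat" and r :: nat
  assumes "simplicial_complex_on m \<Delta>"
    and "\<forall>i\<in>{1..m}. 0 < rs i"
    and "\<forall>i\<in>{1..m}. rs i = r"
  shows "real (matrix_rank (model_rows \<Delta> rs) (model_columns m rs) model_entry) =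
      exp_hilbert_complex TYPE('k::field) m \<Delta> (ln (real r)) \<and>
    exp_hilbert_complex TYPE('k) m \<Delta> (ln (real r)) =
      (\<Sum>k = 0..nat (complex_dim \<Delta> + 1). real_of_int (e_number \<Delta> k) * real r ^ k)"
proof -
  let ?F = "\<Sum>\<sigma>\<in>\<Delta>. (real r - 1) ^ card \<sigma>"
  have pos: "0 < r" if "\<sigma> \<in> \<Delta>" "f \<in> \<sigma>" for \<sigma> f
    using that assms(2,3) simplicial_complex_onD(3)[OF assms(1)] by fastforce
  have "real (matrix_rank (model_rows \<Delta> rs) (model_columns m rs) model_entry) =
      (\<Sum>\<sigma>\<in>\<Delta>. \<Prod>f\<in>\<sigma>. real (rs f - 1))"
    by (simp add: rank_hierarchical_model[OF assms(1,2)])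
  also have "\<dots> = (\<Sum>\<sigma>\<in>\<Delta>. \<Prod>f\<in>\<sigma>. real r - 1)"
  proof (intro sum.cong prod.cong refl)
    fix \<sigma> f assume \<sigma>: "\<sigma> \<in> \<Delta>" "f \<in> \<sigma>"
    then have "rs f = r" using assms(3) simplicial_complex_onD(3)[OF assms(1)] by blast
    then show "real (rs f - 1) = real r - 1" using pos[OF \<sigma>] by (simp add: of_nat_diff)
  qed
  also have "\<dots> = ?F" by simp
  finally have rank: "real (matrix_rank (model_rows \<Delta> rs) (model_columns m rs) model_entry) = ?F" .
  have "exp_hilbert_complex TYPE('k) m \<Delta> (ln (real r)) =
      (\<Sum>\<sigma>\<in>\<Delta>. \<Prod>f\<in>\<sigma>. exp (ln (real r)) - 1)"
    unfolding exp_hilbert_complex_def by (rule exp_hilbert_series_stanley_reisner[OF assms(1)])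
  also have "\<dots> = (\<Sum>\<sigma>\<in>\<Delta>. \<Prod>f\<in>\<sigma>. real r - 1)"
    \<comment> \<open>For \<open>m = 0\<close> the size \<open>r\<close> may be 0, but then no factor \<open>exp (ln r) - 1\<close> occurs.\<close>
    using pos by (intro sum.cong prod.cong refl) simp
  also have "\<dots> = ?F" by simp
  finally show ?thesis
    using rank f_polynomial_eq_e_polynomial[OF assms(1), of "real r"] by simp
qed

end
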